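(* Let $\mathbf{x}:U\to\mathbb{R}^3$ be a proper frontal, $\mathbf{\Omega}$ a tangent moving basis of $\mathbf{x}$ and $\mathbf{n}$ the normal vector field induced by $\mathbf{\Omega}$. Then the following statements are equivalent: (i) the normal curvature of $\mathbf{x}$ has a smooth extension; (ii) the entries of the matrix $\mathbf{II}_\Omega\,\mathrm{adj}(\mathbf{\Lambda}_\Omega^T)$ belong to $\mathfrak{T}_\Omega(U)$; (iii) $\mathbf{x}\precsim\mathbf{n}$.
   Context: All maps are $C^\infty$ and $U\subset\mathbb{R}^2$ is open. For $\mathbf{x}:U\to\mathbb{R}^3$, $D\mathbf{x}$ is the $3\times2$ Jacobian matrix. A tangent moving basis (tmb) of $\mathbf{x}$ is a smooth map $\mathbf{\Omega}=(\mathbf{w}_1\ \mathbf{w}_2):U\to\mathcal{M}_{3\times2}(\mathbb{R})$ with columns linearly independent at every point and $\mathbf{x}_u,\mathbf{x}_v\in\mathrm{span}(\mathbf{w}_1,\mathbf{w}_2)$. The map $\mathbf{x}$ is a frontal if near each point there is a smooth unit vector field orthogonal to $\mathbf{x}_u,\mathbf{x}_v$; equivalently, tmbs exist locally, and frontals are always assumed to have a global tmb. The normal field induced by $\mathbf{\Omega}$ is $\mathbf{n}=\frac{\mathbf{w}_1\times\mathbf{w}_2}{\|\mathbf{w}_1\times\mathbf{w}_2\|}$. $\Sigma(\mathbf{x})$ is the set of points where $\mathbf{x}$ is not immersive; the frontal is proper if $\Sigma(\mathbf{x})$ has empty interior. Set $\mathbf{I}=D\mathbf{x}^TD\mathbf{x}$,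 $\mathbf{II}=-D\mathbf{x}^TD\mathbf{n}$, $\mathbf{I}_\Omega=\mathbf{\Omega}^T\mathbf{\Omega}$, $\mathbf{II}_\Omega=-\mathbf{\Omega}^TD\mathbf{n}$, $\mathbf{\Lambda}_\Omega=D\mathbf{x}^T\mathbf{\Omega}\,\mathbf{I}_\Omega^{-1}$ (so $D\mathbf{x}=\mathbf{\Omega}\mathbf{\Lambda}_\Omega^T$), $\lambda_\Omega=\det\mathbf{\Lambda}_\Omega$. $\mathfrak{T}_\Omega(U)$ is the principal ideal of $C^\infty(U,\mathbb{R})$ generated by $\lambda_\Omega$. $\mathrm{adj}$ denotes the adjugate matrix. Normal curvature: at $p\in\Sigma(\mathbf{x})^c$, $k_p(\zeta)=\frac{\zeta^T\mathbf{II}\zeta}{\zeta^T\mathbf{I}\zeta}$ for $\zeta\in\mathbb{R}^2-\{0\}$. The normal curvature has a smooth extension (is extendable) if the function $(p,\omega)\mapsto k_p(\mathbf{\Lambda}_\Omega^{-T}\omega)$ on $\Sigma(\mathbf{x})^c\times(\mathbb{R}^2-\{0\})$ has a smooth extension to $U\times(\mathbb{R}^2-\{0\})$. For frontals $\mathbf{x}_1,\mathbf{x}_2$ on $U$, $\mathbf{x}_1\precsim\mathbf{x}_2$ means that there exist tmbs $\mathbf{\Omega}_1,\mathbf{\Omega}_2$ of $\mathbf{x}_1,\mathbf{x}_2$ respectively and a smooth map $\mathbf{B}:U\to\mathcal{M}_{2\times2}(\mathbb{R})$ with $\mathbf{\Lambda}_{\Omega_2}=\mathbf{\Lambda}_{\Omega_1}\mathbf{B}$.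 Here $\mathbf{\Lambda}_{\Omega_i}=D\mathbf{x}_i^T\mathbf{\Omega}_i(\mathbf{\Omega}_i^T\mathbf{\Omega}_i)^{-1}$. The map $\mathbf{n}$ is itself regarded as a frontal $U\to\mathbb{R}^3$ ($\mathbf{\Omega}$ is also a tmb of $\mathbf{n}$). *)

theory Defs
  imports "HOL-Analysis.Analysis"
begin

text \<open>
  Maps on an open set \<open>U\<close> are total functions whose values outside \<open>U\<close> are irrelevant; the
  \<open>C\<^sup>k\<close> and \<open>C\<^sup>\<infinity>\<close> predicates below use full derivatives \<open>at p\<close> and are meant for open sets only.
\<close>

fun Ck_on :: "nat \<Rightarrow> 'a::euclidean_space set \<Rightarrow> ('a \<Rightarrow> 'b::euclidean_space) \<Rightarrow> bool" where
  "Ck_on 0 U f \<longleftrightarrow> continuous_on U f"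
| "Ck_on (Suc k) U f \<longleftrightarrow>
     (\<forall>p\<in>U. f differentiable (at p)) \<and>
     (\<forall>v. Ck_on k U (\<lambda>p. frechet_derivative f (at p) v))"

definition smooth_on :: "'a::euclidean_space set \<Rightarrow> ('a \<Rightarrow> 'b::euclidean_space) \<Rightarrow> bool" where
  "smooth_on U f \<longleftrightarrow> (\<forall>k. Ck_on k U f)"

text \<open>
  The adjugate is the transpose of the cofactor matrix; the \<open>(j,i)\<close> cofactor of \<open>A\<close> is the
  determinant of \<open>A\<close> with its \<open>j\<close>-th row replaced by the \<open>i\<close>-th unit vector.
\<close>

definition adjugate :: "'a::comm_ring_1^'n^'n \<Rightarrow> 'a^'n^'n" where
  "adjugate A = (\<chi> i j. det (\<chi> k. if k = j then axis i 1 else A $ k))"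

lemma adjugate_2:
  fixes A :: "'a::comm_ring_1^2^2"
  shows "adjugate A = vector [vector [A$2$2, - A$1$2], vector [- A$2$1, A$1$1]]"
  by (simp add: adjugate_def vec_eq_iff forall_2 det_2 axis_def)

text \<open>A \<open>3 \<times> 2\<close> matrix has type \<^typ>\<open>real^2^3\<close>.\<close>

definition tangent_moving_basis ::
  "(real^2) set \<Rightarrow> (real^2 \<Rightarrow> real^3) \<Rightarrow> (real^2 \<Rightarrow> real^2^3) \<Rightarrow> bool" where
  "tangent_moving_basis U x \<Omega> \<longleftrightarrow>
     smooth_on U \<Omega> \<and>
     (\<forall>p\<in>U.
        (let w1 = column 1 (\<Omega> p); w2 = column 2 (\<Omega> p) in
           w1 \<noteq> w2 \<and> independent {w1, w2} \<and>
           column 1 (jacobian x (at p)) \<in> span {w1, w2} \<and>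
           column 2 (jacobian x (at p)) \<in> span {w1, w2}))"

text \<open>The last conjunct is the standing convention that frontals admit a global tangent moving basis.\<close>

definition frontal :: "(real^2) set \<Rightarrow> (real^2 \<Rightarrow> real^3) \<Rightarrow> bool" where
  "frontal U x \<longleftrightarrow>
     smooth_on U x \<and>
     (\<forall>p\<in>U. \<exists>V \<nu>. open V \<and> p \<in> V \<and> V \<subseteq> U \<and> smooth_on V \<nu> \<and>
        (\<forall>q\<in>V. norm (\<nu> q) = 1 \<and>
           \<nu> q \<bullet> column 1 (jacobian x (at q)) = 0 \<and>
           \<nu> q \<bullet> column 2 (jacobian x (at q)) = 0)) \<and>
     (\<exists>\<Omega>. tangent_moving_basis U x \<Omega>)"

definition singular_set :: "(real^2) set \<Rightarrow> (real^2 \<Rightarrow> real^3) \<Rightarrow> (real^2) set" where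
  "singular_set U x = {p\<in>U. \<not> inj (frechet_derivative x (at p))}"

definition proper_frontal :: "(real^2) set \<Rightarrow> (real^2 \<Rightarrow> real^3) \<Rightarrow> bool" where
  "proper_frontal U x \<longleftrightarrow> frontal U x \<and> interior (singular_set U x) = {}"

definition normal_field :: "(real^2 \<Rightarrow> real^2^3) \<Rightarrow> real^2 \<Rightarrow> real^3" where
  "normal_field \<Omega> p =
     (let w = cross3 (column 1 (\<Omega> p)) (column 2 (\<Omega> p)) in w /\<^sub>R norm w)"

definition first_form :: "(real^2 \<Rightarrow> real^3) \<Rightarrow> real^2 \<Rightarrow> real^2^2" where
  "first_form x p = transpose (jacobian x (at p)) ** jacobian x (at p)"

definition second_form :: "(real^2 \<Rightarrow> real^3) \<Rightarrow> (real^2 \<Rightarrow> real^3) \<Rightarrow> real^2 \<Rightarrow> real^2^2" where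
  "second_form x n p = - (transpose (jacobian x (at p)) ** jacobian n (at p))"

definition I_tmb :: "(real^2 \<Rightarrow> real^2^3) \<Rightarrow> real^2 \<Rightarrow> real^2^2" where
  "I_tmb \<Omega> p = transpose (\<Omega> p) ** \<Omega> p"

definition II_tmb :: "(real^2 \<Rightarrow> real^2^3) \<Rightarrow> real^2 \<Rightarrow> real^2^2" where
  "II_tmb \<Omega> p = - (transpose (\<Omega> p) ** jacobian (normal_field \<Omega>) (at p))"

definition Lambda_tmb :: "(real^2 \<Rightarrow> real^3) \<Rightarrow> (real^2 \<Rightarrow> real^2^3) \<Rightarrow> real^2 \<Rightarrow> real^2^2" where
  "Lambda_tmb x \<Omega> p = transpose (jacobian x (at p)) ** \<Omega> p ** matrix_inv (I_tmb \<Omega> p)"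

definition lambda_tmb :: "(real^2 \<Rightarrow> real^3) \<Rightarrow> (real^2 \<Rightarrow> real^2^3) \<Rightarrow> real^2 \<Rightarrow> real" where
  "lambda_tmb x \<Omega> p = det (Lambda_tmb x \<Omega> p)"

text \<open>
  The principal ideal generated by \<open>g\<close> in the ring of smooth functions on \<open>U\<close>; functions are
  identified when they agree on \<open>U\<close>.
\<close>

definition principal_ideal_on :: "(real^2) set \<Rightarrow> (real^2 \<Rightarrow> real) \<Rightarrow> (real^2 \<Rightarrow> real) set" where
  "principal_ideal_on U g = {f. \<exists>h. smooth_on U h \<and> (\<forall>p\<in>U. f p = h p * g p)}"

definition T_ideal ::
  "(real^2) set \<Rightarrow> (real^2 \<Rightarrow> real^3) \<Rightarrow> (real^2 \<Rightarrow> real^2^3) \<Rightarrow> (real^2 \<Rightarrow> real) set" where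
  "T_ideal U x \<Omega> = principal_ideal_on U (lambda_tmb x \<Omega>)"

definition normal_curvature ::
  "(real^2 \<Rightarrow> real^3) \<Rightarrow> (real^2 \<Rightarrow> real^3) \<Rightarrow> real^2 \<Rightarrow> real^2 \<Rightarrow> real" where
  "normal_curvature x n p \<zeta> = (\<zeta> \<bullet> (second_form x n p *v \<zeta>)) / (\<zeta> \<bullet> (first_form x p *v \<zeta>))"

definition normal_curvature_extendable ::
  "(real^2) set \<Rightarrow> (real^2 \<Rightarrow> real^3) \<Rightarrow> (real^2 \<Rightarrow> real^2^3) \<Rightarrow> bool" where
  "normal_curvature_extendable U x \<Omega> \<longleftrightarrow>
     (\<exists>K :: (real^2) \<times> (real^2) \<Rightarrow> real.
        smooth_on (U \<times> (UNIV - {0})) K \<and>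
        (\<forall>p \<in> U - singular_set U x. \<forall>\<omega> \<in> UNIV - {0}.
           K (p, \<omega>) =
             normal_curvature x (normal_field \<Omega>) p
               (matrix_inv (transpose (Lambda_tmb x \<Omega> p)) *v \<omega>)))"

definition frontal_precsim ::
  "(real^2) set \<Rightarrow> (real^2 \<Rightarrow> real^3) \<Rightarrow> (real^2 \<Rightarrow> real^3) \<Rightarrow> bool" where
  "frontal_precsim U x1 x2 \<longleftrightarrow>
     frontal U x1 \<and> frontal U x2 \<and>
     (\<exists>\<Omega>1 \<Omega>2. \<exists>B :: real^2 \<Rightarrow> real^2^2.
        tangent_moving_basis U x1 \<Omega>1 \<and> tangent_moving_basis U x2 \<Omega>2 \<and> smooth_on U B \<and>
        (\<forall>p\<in>U. Lambda_tmb x2 \<Omega>2 p = Lambda_tmb x1 \<Omega>1 p ** B p))"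

end

theory Submission
  imports Defs
begin

text \<open>
  Write \<open>L\<close> for \<open>\<Lambda>\<^sub>\<Omega>\<close>, \<open>G\<close> for \<open>I\<^sub>\<Omega>\<close>, \<open>H\<close> for \<open>II\<^sub>\<Omega>\<close> and \<open>\<lambda>\<close> for \<open>det L\<close>. Everything rests on
  \<open>Dx = \<Omega> L\<^sup>T\<close> (\<open>jacobian_eq_frame_Lambda\<close>), which gives \<open>II = L H\<close> and \<open>I = L G L\<^sup>T\<close>, and
  shows that \<open>L\<close> is invertible wherever \<open>x\<close> is immersive. There
  \<open>H adj(L\<^sup>T) = \<lambda> S\<close> with \<open>S = H L\<^sup>-\<^sup>T\<close>, so the ideal condition says exactly that \<open>S\<close> extends to a
  smooth matrix \<open>C\<close> with \<open>H adj(L\<^sup>T) = \<lambda> C\<close> on \<open>U\<close> (\<open>ideal_iff_smooth_quotient\<close>). Properness makes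
  the immersive points dense, hence an identity between continuous maps need only be checked there
  (\<open>continuous_zero_of_dense\<close>).

  \<^item> Curvature and ideal. Substituting \<open>\<zeta> = L\<^sup>-\<^sup>T \<omega>\<close> turns the normal curvature into
    \<open>(\<omega>\<^sup>T S \<omega>) / (\<omega>\<^sup>T G \<omega>)\<close> (\<open>normal_curvature_in_frame\<close>), whose denominator never vanishes. Thus a
    smooth extension of \<open>S\<close> yields one of the curvature. Conversely a smooth extension of the
    curvature yields one of the quadratic form of \<open>S\<close>, and this form determines \<open>S\<close> because \<open>S\<close> is
    symmetric. The symmetry of \<open>S = L\<^sup>-\<^sup>1 II L\<^sup>-\<^sup>T\<close> is that of \<open>II\<close>, which is the commutation of
    second derivatives of \<open>x\<close>.

  \<^item> Ideal and \<open>x \<precsim> n\<close>. Both amount to a factorization \<open>H = C L\<^sup>T\<close> with \<open>C\<close> smooth. From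
    \<open>H adj(L\<^sup>T) = \<lambda> C\<close> it follows at immersive points, hence everywhere by density, and transposing
    gives \<open>\<Lambda>\<^sub>\<Omega>(n) = - H\<^sup>T G\<^sup>-\<^sup>1 = L B\<close> with \<open>B = - C\<^sup>T G\<^sup>-\<^sup>1\<close>. Conversely, if \<open>x \<precsim> n\<close> holds with
    bases \<open>\<Omega>\<^sub>1\<close> and \<open>\<Omega>\<^sub>2\<close>, then \<open>Dn = \<Omega>\<^sub>2 B\<^sup>T \<Lambda>\<^sub>1\<^sup>T\<close>, and \<open>\<Lambda>\<^sub>1 = L P\<close> for a smooth \<open>P\<close>, whatever the
    bases are; multiplying \<open>H = - \<Omega>\<^sup>T Dn = C L\<^sup>T\<close> by \<open>adj(L\<^sup>T)\<close> gives back the ideal condition.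
\<close>

section \<open>Closure properties of smooth maps\<close>

text \<open>
  Differentiability and derivatives at a point are local, and \<open>U\<close> is a neighbourhood of each of its
  points; so values outside \<open>U\<close> do not matter, at any order.
\<close>

lemma Ck_on_cong:
  fixes f g :: "'a::euclidean_space \<Rightarrow> 'b::euclidean_space"
  assumes "open U" "\<And>p. p \<in> U \<Longrightarrow> f p = g p"
  shows "Ck_on k U f \<longleftrightarrow> Ck_on k U g"
  using assms(2)
proof (induction k arbitrary: f g)
  case 0
  then show ?case by (simp cong: continuous_on_cong)
next
  case (Suc k)
  have imp: "Ck_on (Suc k) U h" if "Ck_on (Suc k) U h'" and eq: "\<And>p. p \<in> U \<Longrightarrow> h' p = h p"
    for h h' :: "'a \<Rightarrow> 'b"
  proof -
    have "h differentiable (at p)" if "p \<in> U" for p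
      using \<open>Ck_on (Suc k) U h'\<close> eq that \<open>open U\<close>
      by (metis Ck_on.simps(2) differentiable_def has_derivative_transform_within_open)
    moreover have "frechet_derivative h' (at p) = frechet_derivative h (at p)" if "p \<in> U" for p
      using frechet_derivative_transform_within_open[OF _ \<open>open U\<close> that eq]
        \<open>Ck_on (Suc k) U h'\<close> that by auto
    then have "Ck_on k U (\<lambda>p. frechet_derivative h (at p) v)" for v
      using Suc.IH[of "\<lambda>p. frechet_derivative h' (at p) v" "\<lambda>p. frechet_derivative h (at p) v"]
        \<open>Ck_on (Suc k) U h'\<close> by simp
    ultimately show ?thesis by simp
  qed
  show ?case
    using imp[of f g] imp[of g f] Suc.prems by metis
qed

text \<open>
  The introduction rule behind all closure properties below: it lets one name the derivative by a
  formula instead of through the choice operator in \<^const>\<open>frechet_derivative\<close>. Each closure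
  property then follows by induction on the order, since the derivative is again built from the same
  operations.
\<close>

lemma Ck_on_SucI:
  assumes "open U" "\<And>p. p \<in> U \<Longrightarrow> (f has_derivative f' p) (at p)"
    and "\<And>v. Ck_on k U (\<lambda>p. f' p v)"
  shows "Ck_on (Suc k) U f"
proof -
  have "frechet_derivative f (at p) = f' p" if "p \<in> U" for p
    using assms(2)[OF that] frechet_derivative_at by metis
  then have "Ck_on k U (\<lambda>p. frechet_derivative f (at p) v)" for v
    using Ck_on_cong[OF assms(1), of "\<lambda>p. frechet_derivative f (at p) v" "\<lambda>p. f' p v"] assms(3)
    by simp
  then show ?thesis
    using assms(2) by (auto simp: differentiable_def)
qed

lemma Ck_on_SucD:
  assumes "Ck_on (Suc k) U f" "p \<in> U"
  shows "(f has_derivative frechet_derivative f (at p)) (at p)"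
  using assms by (simp add: frechet_derivative_works)

lemma Ck_on_antimono: "Ck_on (Suc k) U f \<Longrightarrow> Ck_on k U f"
proof (induction k arbitrary: f)
  case 0
  then show ?case
    by (auto intro!: continuous_at_imp_continuous_on differentiable_imp_continuous_within)
qed auto

lemma Ck_on_const: "open U \<Longrightarrow> Ck_on k U (\<lambda>p. c)"
  by (induction k arbitrary: c) auto

lemma Ck_on_linear:
  assumes "open U" "bounded_linear L" "Ck_on k U f"
  shows "Ck_on k U (\<lambda>p. L (f p))"
  using assms(3)
proof (induction k arbitrary: f)
  case 0
  then show ?case
    using bounded_linear.continuous_on[OF assms(2)] by auto
next
  case (Suc k)
  show ?case
    by (rule Ck_on_SucI[OF assms(1) bounded_linear.has_derivative[OF assms(2) Ck_on_SucD[OF Suc.prems]]])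
       (use Suc in auto)
qed

lemma Ck_on_affine:
  assumes "open U" "open V" "bounded_linear L" "\<And>p. p \<in> V \<Longrightarrow> L p + c \<in> U" "Ck_on k U f"
  shows "Ck_on k V (\<lambda>p. f (L p + c))"
  using assms(5)
proof (induction k arbitrary: f)
  case 0
  have "continuous_on V (\<lambda>p. L p + c)"
    by (intro continuous_intros linear_continuous_on assms(3))
  with 0 assms(4) show ?case
    by (auto intro!: continuous_on_compose2[of U f])
next
  case (Suc k)
  show ?case
  proof (rule Ck_on_SucI[OF \<open>open V\<close>])
    fix p assume "p \<in> V"
    have "((\<lambda>p. L p + c) has_derivative L) (at p)"
      by (auto intro!: derivative_eq_intros bounded_linear.has_derivative[OF assms(3)])
    from has_derivative_compose[OF this Ck_on_SucD[OF Suc.prems assms(4)[OF \<open>p \<in> V\<close>]]]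
    show "((\<lambda>p. f (L p + c)) has_derivative (\<lambda>v. frechet_derivative f (at (L p + c)) (L v))) (at p)" .
  next
    fix v show "Ck_on k V (\<lambda>p. frechet_derivative f (at (L p + c)) (L v))"
      using Suc.IH[of "\<lambda>q. frechet_derivative f (at q) (L v)"] Suc.prems by simp
  qed
qed

lemma Ck_on_add:
  assumes "open U" "Ck_on k U f" "Ck_on k U g"
  shows "Ck_on k U (\<lambda>p. f p + g p)"
  using assms(2,3)
proof (induction k arbitrary: f g)
  case 0
  then show ?case by (auto intro: continuous_intros)
next
  case (Suc k)
  show ?case
    by (rule Ck_on_SucI[OF assms(1) has_derivative_add[OF Ck_on_SucD[OF Suc.prems(1)] Ck_on_SucD[OF Suc.prems(2)]]])
       (use Suc in auto)
qed

text \<open>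
  By the product rule the derivative is a sum of two terms of the same shape. The induction hypothesis
  needs all four factors at order \<open>k\<close>, so the undifferentiated ones are weakened by one order. The
  lemma covers products, scalar multiples, inner products and the cross product at once.
\<close>

lemma Ck_on_bilinear:
  assumes "open U" "bounded_bilinear b" "Ck_on k U f" "Ck_on k U g"
  shows "Ck_on k U (\<lambda>p. b (f p) (g p))"
  using assms(3,4)
proof (induction k arbitrary: f g)
  case 0
  then show ?case using bounded_bilinear.continuous_on[OF assms(2)] by auto
next
  case (Suc k)
  show ?case
  proof (rule Ck_on_SucI[OF assms(1)])
    show "((\<lambda>p. b (f p) (g p)) has_derivative
        (\<lambda>v. b (f p) (frechet_derivative g (at p) v) + b (frechet_derivative f (at p) v) (g p))) (at p)"
      if "p \<in> U" for p
      using bounded_bilinear.FDERIV[OF assms(2) Ck_on_SucD[OF Suc.prems(1) that] Ck_on_SucD[OF Suc.prems(2) that]] .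
    have "Ck_on k U f" "Ck_on k U g" "Ck_on k U (\<lambda>p. frechet_derivative f (at p) v)"
      "Ck_on k U (\<lambda>p. frechet_derivative g (at p) v)" for v
      using Suc.prems Ck_on_antimono by (blast, blast, simp_all)
    then show "Ck_on k U (\<lambda>p. b (f p) (frechet_derivative g (at p) v) + b (frechet_derivative f (at p) v) (g p))" for v
      by (intro Ck_on_add[OF assms(1)] Suc.IH)
  qed
qed

text \<open>
  The derivative \<open>- f\<^sup>-\<^sup>1 f' f\<^sup>-\<^sup>1\<close> again involves only \<open>f\<^sup>-\<^sup>1\<close> and \<open>f'\<close>, so the induction closes without a
  general chain rule.
\<close>

lemma Ck_on_inverse:
  fixes f :: "'a::euclidean_space \<Rightarrow> real"
  assumes "open U" "Ck_on k U f" "\<And>p. p \<in> U \<Longrightarrow> f p \<noteq> 0"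
  shows "Ck_on k U (\<lambda>p. inverse (f p))"
  using assms(2)
proof (induction k)
  case 0
  then show ?case using assms(3) by (auto intro: continuous_intros)
next
  case (Suc k)
  have inv: "Ck_on k U (\<lambda>p. inverse (f p))"
    using Suc Ck_on_antimono by blast
  have f': "Ck_on k U (\<lambda>p. frechet_derivative f (at p) v)" for v
    using Suc.prems by simp
  note mult = Ck_on_bilinear[OF assms(1) bounded_bilinear_mult]
  show ?case
  proof (rule Ck_on_SucI[OF assms(1)])
    show "((\<lambda>p. inverse (f p)) has_derivative
        (\<lambda>v. - (inverse (f p) * frechet_derivative f (at p) v * inverse (f p)))) (at p)" if "p \<in> U" for p
      by (rule Deriv.has_derivative_inverse[OF assms(3)[OF that] Ck_on_SucD[OF Suc.prems that]])
    show "Ck_on k U (\<lambda>p. - (inverse (f p) * frechet_derivative f (at p) v * inverse (f p)))" for v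
      by (intro Ck_on_linear[OF assms(1) bounded_linear_minus[OF bounded_linear_ident]] mult inv f')
  qed
qed

text \<open>
  The reciprocal \<open>r\<close> of the norm satisfies \<open>r' = - r\<^sup>3 (f' \<bullet> f)\<close>, a polynomial in \<open>r\<close>, \<open>f\<close> and \<open>f'\<close>,
  so the induction closes as for \<open>Ck_on_inverse\<close>.
\<close>

lemma Ck_on_inverse_norm:
  fixes f :: "'a::euclidean_space \<Rightarrow> 'b::euclidean_space"
  assumes "open U" "Ck_on k U f" "\<And>p. p \<in> U \<Longrightarrow> f p \<noteq> 0"
  shows "Ck_on k U (\<lambda>p. inverse (norm (f p)))"
  using assms(2)
proof (induction k)
  case 0
  then show ?case using assms(3) by (auto intro!: continuous_intros)
next
  case (Suc k)
  let ?r = "\<lambda>p. inverse (norm (f p))"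
  have r: "Ck_on k U ?r" and f: "Ck_on k U f"
    using Suc Ck_on_antimono by blast+
  have f': "Ck_on k U (\<lambda>p. frechet_derivative f (at p) v)" for v
    using Suc.prems by simp
  note mult = Ck_on_bilinear[OF assms(1) bounded_bilinear_mult]
    and inner = Ck_on_bilinear[OF assms(1) bounded_bilinear_inner]
  show ?case
  proof (rule Ck_on_SucI[OF assms(1)])
    fix p assume p: "p \<in> U"
    have "((\<lambda>p. norm (f p)) has_derivative (\<lambda>v. frechet_derivative f (at p) v \<bullet> sgn (f p))) (at p)"
      using has_derivative_compose[OF Ck_on_SucD[OF Suc.prems p] has_derivative_norm[OF assms(3)[OF p]]] .
    from Deriv.has_derivative_inverse[OF _ this] assms(3)[OF p]
    have "(?r has_derivative (\<lambda>v. - (?r p * (frechet_derivative f (at p) v \<bullet> sgn (f p)) * ?r p))) (at p)"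
      by simp
    then show "(?r has_derivative
        (\<lambda>v. - (?r p * (?r p * (frechet_derivative f (at p) v \<bullet> f p)) * ?r p))) (at p)"
      by (simp add: sgn_div_norm)
  next
    show "Ck_on k U (\<lambda>p. - (?r p * (?r p * (frechet_derivative f (at p) v \<bullet> f p)) * ?r p))" for v
      by (intro Ck_on_linear[OF assms(1) bounded_linear_minus[OF bounded_linear_ident]] mult r inner f' f)
  qed
qed

lemma smooth_on_cong:
  "open U \<Longrightarrow> (\<And>p. p \<in> U \<Longrightarrow> f p = g p) \<Longrightarrow> smooth_on U f \<longleftrightarrow> smooth_on U g"
  using Ck_on_cong[of U f g] by (simp only: smooth_on_def)

lemma smooth_on_const: "open U \<Longrightarrow> smooth_on U (\<lambda>p. c)"
  by (simp add: smooth_on_def Ck_on_const)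

lemma smooth_on_linear:
  "open U \<Longrightarrow> bounded_linear L \<Longrightarrow> smooth_on U f \<Longrightarrow> smooth_on U (\<lambda>p. L (f p))"
  unfolding smooth_on_def using Ck_on_linear[of U L _ f] by blast

lemma smooth_on_affine:
  assumes "open U" "open V" "bounded_linear L" "\<And>p. p \<in> V \<Longrightarrow> L p + c \<in> U" "smooth_on U f"
  shows "smooth_on V (\<lambda>p. f (L p + c))"
  using assms(5) unfolding smooth_on_def using Ck_on_affine[OF assms(1-4)] by blast

lemma smooth_on_add:
  "open U \<Longrightarrow> smooth_on U f \<Longrightarrow> smooth_on U g \<Longrightarrow> smooth_on U (\<lambda>p. f p + g p)"
  unfolding smooth_on_def using Ck_on_add[of U _ f g] by blast

lemma smooth_on_bilinear:
  "open U \<Longrightarrow> bounded_bilinear b \<Longrightarrow> smooth_on U f \<Longrightarrow> smooth_on U g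
    \<Longrightarrow> smooth_on U (\<lambda>p. b (f p) (g p))"
  unfolding smooth_on_def using Ck_on_bilinear[of U b _ f g] by blast

lemma smooth_on_inverse:
  fixes f :: "'a::euclidean_space \<Rightarrow> real"
  shows "open U \<Longrightarrow> smooth_on U f \<Longrightarrow> (\<And>p. p \<in> U \<Longrightarrow> f p \<noteq> 0) \<Longrightarrow> smooth_on U (\<lambda>p. inverse (f p))"
  unfolding smooth_on_def using Ck_on_inverse[of U _ f] by blast

lemma smooth_on_inverse_norm:
  fixes f :: "'a::euclidean_space \<Rightarrow> 'b::euclidean_space"
  shows "open U \<Longrightarrow> smooth_on U f \<Longrightarrow> (\<And>p. p \<in> U \<Longrightarrow> f p \<noteq> 0) \<Longrightarrow> smooth_on U (\<lambda>p. inverse (norm (f p)))"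
  unfolding smooth_on_def using Ck_on_inverse_norm[of U _ f] by blast

lemmas smooth_on_mult = smooth_on_bilinear[OF _ bounded_bilinear_mult]
lemmas smooth_on_scaleR = smooth_on_bilinear[OF _ bounded_bilinear_scaleR]
lemmas smooth_on_inner = smooth_on_bilinear[OF _ bounded_bilinear_inner]
lemmas smooth_on_uminus = smooth_on_linear[OF _ bounded_linear_minus[OF bounded_linear_ident]]

lemma smooth_on_sum:
  "open U \<Longrightarrow> (\<And>i. i \<in> A \<Longrightarrow> smooth_on U (f i)) \<Longrightarrow> smooth_on U (\<lambda>p. \<Sum>i\<in>A. f i p)"
proof (induction rule: infinite_finite_induct)
  case (insert i A)
  then show ?case using smooth_on_add[of U "f i" "\<lambda>p. \<Sum>i\<in>A. f i p"] by simp
qed (simp_all add: smooth_on_const)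

lemma smooth_on_euclidean:
  assumes "open U"
  shows "smooth_on U f \<longleftrightarrow> (\<forall>b\<in>Basis. smooth_on U (\<lambda>p. f p \<bullet> b))"
proof
  assume R: "\<forall>b\<in>Basis. smooth_on U (\<lambda>p. f p \<bullet> b)"
  have "smooth_on U (\<lambda>p. \<Sum>b\<in>Basis. (f p \<bullet> b) *\<^sub>R b)"
    using R assms by (intro smooth_on_sum smooth_on_scaleR smooth_on_const) blast+
  then show "smooth_on U f" by (simp add: euclidean_representation)
qed (intro ballI smooth_on_inner smooth_on_const assms)

lemma smooth_on_vec:
  fixes f :: "'a::euclidean_space \<Rightarrow> 'b::euclidean_space ^ 'n"
  assumes "open U"
  shows "smooth_on U f \<longleftrightarrow> (\<forall>i. smooth_on U (\<lambda>p. f p $ i))"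
proof -
  have "smooth_on U f \<longleftrightarrow> (\<forall>i. \<forall>b\<in>Basis. smooth_on U (\<lambda>p. f p \<bullet> axis i b))"
    unfolding smooth_on_euclidean[OF assms, of f] by (auto simp: Basis_vec_def)
  also have "\<dots> \<longleftrightarrow> (\<forall>i. smooth_on U (\<lambda>p. f p $ i))"
    unfolding smooth_on_euclidean[OF assms, of "\<lambda>p. f p $ i" for i] by (simp add: inner_axis)
  finally show ?thesis .
qed

lemma smooth_on_imp_continuous_on: "smooth_on U f \<Longrightarrow> continuous_on U f"
  unfolding smooth_on_def by (metis Ck_on.simps(1))

lemma smooth_on_differentiable: "smooth_on U f \<Longrightarrow> p \<in> U \<Longrightarrow> f differentiable at p"
  unfolding smooth_on_def by (metis Ck_on.simps(2))

lemma smooth_on_frechet_derivative: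
  "smooth_on U f \<Longrightarrow> smooth_on U (\<lambda>p. frechet_derivative f (at p) v)"
  unfolding smooth_on_def by (metis Ck_on.simps(2))

section \<open>Second derivatives commute\<close>

lemma has_real_derivative_along_line:
  fixes f :: "'a::real_normed_vector \<Rightarrow> real"
  assumes "f differentiable at (q + s *\<^sub>R u)"
  shows "((\<lambda>s. f (q + s *\<^sub>R u)) has_real_derivative frechet_derivative f (at (q + s *\<^sub>R u)) u) (at s)"
proof -
  have line: "((\<lambda>s. q + s *\<^sub>R u) has_derivative (\<lambda>r. r *\<^sub>R u)) (at s)"
    by (auto intro!: derivative_eq_intros)
  have "((\<lambda>s. f (q + s *\<^sub>R u)) has_derivative
      (\<lambda>r. frechet_derivative f (at (q + s *\<^sub>R u)) (r *\<^sub>R u))) (at s)"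
    using has_derivative_compose[OF line] assms by (simp add: frechet_derivative_works)
  then show ?thesis
    using linear_frechet_derivative[OF assms]
    by (simp add: has_field_derivative_def linear_cmul mult.commute[of _ "frechet_derivative _ _ _"])
qed

text \<open>
  The classical double application of the mean value theorem: along \<open>u\<close> to the increment of \<open>f\<close> by
  \<open>h v\<close>, and then along \<open>v\<close> to the derivative that results. The left-hand side is symmetric in \<open>u\<close> and
  \<open>v\<close>, the right-hand side is not; this is where commutation comes from.
\<close>

lemma mixed_difference_mvt:
  fixes f :: "'a::euclidean_space \<Rightarrow> real"
  assumes f: "smooth_on U f" and h: "h > 0"
    and in_U: "\<And>s t. s \<in> {0..h} \<Longrightarrow> t \<in> {0..h} \<Longrightarrow> p + s *\<^sub>R u + t *\<^sub>R v \<in> U"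
  obtains s t where "s \<in> {0..h}" "t \<in> {0..h}"
    "f (p + h *\<^sub>R u + h *\<^sub>R v) - f (p + h *\<^sub>R u) - f (p + h *\<^sub>R v) + f p =
      h * h * frechet_derivative (\<lambda>q. frechet_derivative f (at q) u) (at (p + s *\<^sub>R u + t *\<^sub>R v)) v"
proof -
  let ?fu = "\<lambda>q. frechet_derivative f (at q) u"
  let ?d = "\<lambda>s. ?fu (p + s *\<^sub>R u + h *\<^sub>R v) - ?fu (p + s *\<^sub>R u)"
  have D: "((\<lambda>s. f (p + s *\<^sub>R u + c *\<^sub>R v)) has_real_derivative ?fu (p + s *\<^sub>R u + c *\<^sub>R v)) (at s)"
    if "s \<in> {0..h}" "c \<in> {0..h}" for s c
    using has_real_derivative_along_line[of f "p + c *\<^sub>R v" s u] smooth_on_differentiable[OF f in_U[OF that]]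
    by (simp add: ac_simps)
  have "\<exists>s>0. s < h \<and> (f (p + h *\<^sub>R u + h *\<^sub>R v) - f (p + h *\<^sub>R u)) - (f (p + 0 *\<^sub>R u + h *\<^sub>R v) - f (p + 0 *\<^sub>R u))
      = (h - 0) * ?d s"
    using D[of _ h] D[of _ 0] h
    by (intro MVT2[of 0 h "\<lambda>s. f (p + s *\<^sub>R u + h *\<^sub>R v) - f (p + s *\<^sub>R u)" ?d])
       (auto intro!: derivative_intros)
  then obtain s where "0 < s" "s < h"
    and "(f (p + h *\<^sub>R u + h *\<^sub>R v) - f (p + h *\<^sub>R u)) - (f (p + h *\<^sub>R v) - f p) = h * ?d s"
    by auto
  then have s: "s \<in> {0..h}"
    and 1: "f (p + h *\<^sub>R u + h *\<^sub>R v) - f (p + h *\<^sub>R u) - f (p + h *\<^sub>R v) + f p = h * ?d s"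
    by auto
  have "((\<lambda>t. ?fu (p + s *\<^sub>R u + t *\<^sub>R v)) has_real_derivative
      frechet_derivative ?fu (at (p + s *\<^sub>R u + t *\<^sub>R v)) v) (at t)" if "t \<in> {0..h}" for t
    by (intro has_real_derivative_along_line smooth_on_differentiable[OF _ in_U[OF s that]]
        smooth_on_frechet_derivative f)
  then have "\<exists>t>0. t < h \<and> ?fu (p + s *\<^sub>R u + h *\<^sub>R v) - ?fu (p + s *\<^sub>R u + 0 *\<^sub>R v)
     = (h - 0) * frechet_derivative ?fu (at (p + s *\<^sub>R u + t *\<^sub>R v)) v"
    using h by (intro MVT2[of 0 h "\<lambda>t. ?fu (p + s *\<^sub>R u + t *\<^sub>R v)"]) auto
  then obtain t where "0 < t" "t < h"
    and 2: "?d s = h * frechet_derivative ?fu (at (p + s *\<^sub>R u + t *\<^sub>R v)) v"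
    by auto
  then have t: "t \<in> {0..h}" by simp
  show ?thesis using that[OF s t] 1 2 by simp
qed

lemma mixed_difference_limit:
  fixes f :: "'a::euclidean_space \<Rightarrow> real"
  assumes "open U" "smooth_on U f" "p \<in> U"
  shows "((\<lambda>h. (f (p + h *\<^sub>R u + h *\<^sub>R v) - f (p + h *\<^sub>R u) - f (p + h *\<^sub>R v) + f p) / (h * h))
    \<longlongrightarrow> frechet_derivative (\<lambda>q. frechet_derivative f (at q) u) (at p) v) (at_right 0)"
proof (rule tendstoI)
  fix e :: real assume e: "e > 0"
  let ?G = "\<lambda>q. frechet_derivative (\<lambda>q. frechet_derivative f (at q) u) (at q) v"
  have "continuous_on U ?G"
    by (intro smooth_on_imp_continuous_on smooth_on_frechet_derivative assms)
  then have "isCont ?G p"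
    using assms by (simp add: continuous_on_eq_continuous_at)
  then obtain d1 where d1: "d1 > 0" "\<And>q. dist q p < d1 \<Longrightarrow> dist (?G q) (?G p) < e"
    unfolding continuous_at_eps_delta using e by (metis dist_norm)
  obtain d2 where d2: "d2 > 0" "ball p d2 \<subseteq> U" using assms(1,3) openE by blast
  define d where "d = min d1 d2"
  have "d > 0" using d1 d2 by (simp add: d_def)
  \<comment> \<open>All points \<open>p + s u + t v\<close> with \<open>s, t \<le> h < h0\<close> lie in the ball of radius \<open>d\<close>;
    the summand 1 only keeps the denominator positive.\<close>
  define h0 where "h0 = d / (norm u + norm v + 1)"
  have "h0 > 0" using \<open>d > 0\<close> by (simp add: h0_def add_nonneg_pos)
  have near: "dist (p + s *\<^sub>R u + t *\<^sub>R v) p < d" if "0 < h" "h < h0" "s \<in> {0..h}" "t \<in> {0..h}" for h s t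
  proof -
    have "dist (p + s *\<^sub>R u + t *\<^sub>R v) p = norm (s *\<^sub>R u + t *\<^sub>R v)"
      by (simp add: dist_norm)
    also have "\<dots> \<le> s * norm u + t * norm v"
      using that by (auto intro!: order_trans[OF norm_triangle_ineq])
    also have "\<dots> \<le> h * norm u + h * norm v"
      using that by (intro add_mono mult_right_mono) auto
    also have "\<dots> \<le> h * (norm u + norm v + 1)"
      using that by (simp add: algebra_simps)
    also have "\<dots> < h0 * (norm u + norm v + 1)"
      using that by (intro mult_strict_right_mono) (auto simp: add_nonneg_pos)
    also have "\<dots> = d" by (simp add: h0_def) (metis add_nonneg_pos norm_ge_zero add_nonneg_nonneg less_irrefl zero_less_one)
    finally show ?thesis .
  qed
  have "dist ((f (p + h *\<^sub>R u + h *\<^sub>R v) - f (p + h *\<^sub>R u) - f (p + h *\<^sub>R v) + f p) / (h * h)) (?G p) < e"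
    if h: "0 < h" "h < h0" for h
  proof -
    have "p + s *\<^sub>R u + t *\<^sub>R v \<in> U" if "s \<in> {0..h}" "t \<in> {0..h}" for s t
      using near[OF h that] d2(2) by (auto simp: d_def dist_commute)
    from mixed_difference_mvt[OF assms(2) h(1) this]
    obtain s t where st: "s \<in> {0..h}" "t \<in> {0..h}"
      "f (p + h *\<^sub>R u + h *\<^sub>R v) - f (p + h *\<^sub>R u) - f (p + h *\<^sub>R v) + f p = h * h * ?G (p + s *\<^sub>R u + t *\<^sub>R v)"
      by blast
    then show ?thesis
      using d1(2)[of "p + s *\<^sub>R u + t *\<^sub>R v"] near[OF h st(1,2)] h by (simp add: d_def)
  qed
  then show "\<forall>\<^sub>F h in at_right 0. dist ((f (p + h *\<^sub>R u + h *\<^sub>R v) - f (p + h *\<^sub>R u) - f (p + h *\<^sub>R v) + f p) / (h * h)) (?G p) < e"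
    using \<open>h0 > 0\<close> unfolding eventually_at_right_field by blast
qed

text \<open>
  The difference quotient of the preceding limit is symmetric in the two directions, and limits are
  unique.
\<close>

lemma mixed_derivatives_commute_real:
  fixes f :: "'a::euclidean_space \<Rightarrow> real"
  assumes "open U" "smooth_on U f" "p \<in> U"
  shows "frechet_derivative (\<lambda>q. frechet_derivative f (at q) u) (at p) v =
    frechet_derivative (\<lambda>q. frechet_derivative f (at q) v) (at p) u"
proof (rule tendsto_unique[OF _ mixed_difference_limit[OF assms]])
  show "((\<lambda>h. (f (p + h *\<^sub>R u + h *\<^sub>R v) - f (p + h *\<^sub>R u) - f (p + h *\<^sub>R v) + f p) / (h * h)) \<longlongrightarrow>
     frechet_derivative (\<lambda>q. frechet_derivative f (at q) v) (at p) u) (at_right 0)"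
    using mixed_difference_limit[OF assms, of v u] by (simp add: algebra_simps)
qed auto

lemma frechet_derivative_inner:
  fixes f g :: "'a::real_normed_vector \<Rightarrow> 'b::real_inner"
  assumes "f differentiable at p" "g differentiable at p"
  shows "frechet_derivative (\<lambda>q. f q \<bullet> g q) (at p) v
    = f p \<bullet> frechet_derivative g (at p) v + frechet_derivative f (at p) v \<bullet> g p"
  using frechet_derivative_at[OF has_derivative_inner[OF assms[unfolded frechet_derivative_works]]]
  by metis

lemma frechet_derivative_inner_const:
  assumes "f differentiable at p"
  shows "frechet_derivative (\<lambda>q. f q \<bullet> c) (at p) v = frechet_derivative f (at p) v \<bullet> c"
  using frechet_derivative_inner[OF assms differentiable_const, of c v] by simp

lemma mixed_derivatives_commute:
  fixes f :: "'a::euclidean_space \<Rightarrow> 'b::euclidean_space"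
  assumes "open U" "smooth_on U f" "p \<in> U"
  shows "frechet_derivative (\<lambda>q. frechet_derivative f (at q) u) (at p) v =
    frechet_derivative (\<lambda>q. frechet_derivative f (at q) v) (at p) u"
proof (rule euclidean_eqI)
  fix b :: 'b assume "b \<in> Basis"
  note diff = smooth_on_differentiable
  have *: "frechet_derivative (\<lambda>q. frechet_derivative f (at q) u) (at p) v \<bullet> b
     = frechet_derivative (\<lambda>q. frechet_derivative (\<lambda>q. f q \<bullet> b) (at q) u) (at p) v" for u v
  proof -
    note 1 = diff[OF smooth_on_frechet_derivative[OF assms(2), of u]]
    have "frechet_derivative (\<lambda>q. frechet_derivative f (at q) u) (at p) v \<bullet> b
      = frechet_derivative (\<lambda>q. frechet_derivative f (at q) u \<bullet> b) (at p) v"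
      using 1[OF assms(3)] by (simp add: frechet_derivative_inner_const)
    also have "frechet_derivative (\<lambda>q. frechet_derivative f (at q) u \<bullet> b) (at p)
       = frechet_derivative (\<lambda>q. frechet_derivative (\<lambda>q. f q \<bullet> b) (at q) u) (at p)"
      using 1[OF assms(3)] diff[OF assms(2)]
      by (intro frechet_derivative_transform_within_open[OF _ assms(1,3)])
         (auto simp: frechet_derivative_inner_const)
    finally show ?thesis .
  qed
  show "frechet_derivative (\<lambda>q. frechet_derivative f (at q) u) (at p) v \<bullet> b =
    frechet_derivative (\<lambda>q. frechet_derivative f (at q) v) (at p) u \<bullet> b"
    unfolding * using mixed_derivatives_commute_real[OF assms(1) _ assms(3), of "\<lambda>q. f q \<bullet> b"]
    by (simp add: smooth_on_inner smooth_on_const assms)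
qed

section \<open>Matrices and smooth matrix-valued maps\<close>

lemma smooth_on_ident: "open U \<Longrightarrow> smooth_on U (\<lambda>p. p)"
proof -
  assume "open U"
  have "Ck_on k U (\<lambda>p. p)" for k
    using \<open>open U\<close> by (cases k) (simp_all add: Ck_on_const)
  then show ?thesis by (simp add: smooth_on_def)
qed

lemma smooth_on_matrix_iff:
  fixes A :: "'a::euclidean_space \<Rightarrow> real ^ 'n ^ 'm"
  assumes "open U"
  shows "smooth_on U A \<longleftrightarrow> (\<forall>i j. smooth_on U (\<lambda>p. A p $ i $ j))"
  by (simp only: smooth_on_vec[OF assms])

lemma smooth_on_matrix_entry:
  fixes A :: "'a::euclidean_space \<Rightarrow> real ^ 'n ^ 'm"
  assumes "open U" "smooth_on U A"
  shows "smooth_on U (\<lambda>p. A p $ i $ j)"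
  using smooth_on_matrix_iff[OF assms(1)] assms(2) by blast

lemma smooth_on_matrix_mult:
  fixes A :: "'a::euclidean_space \<Rightarrow> real ^ 'n ^ 'm" and B :: "'a \<Rightarrow> real ^ 'k ^ 'n"
  assumes "open U" "smooth_on U A" "smooth_on U B"
  shows "smooth_on U (\<lambda>p. A p ** B p)"
  unfolding smooth_on_matrix_iff[OF assms(1)] matrix_matrix_mult_def
  by (simp, intro allI smooth_on_sum smooth_on_mult smooth_on_matrix_entry assms)

lemma smooth_on_matrix_vector_mult:
  fixes A :: "'a::euclidean_space \<Rightarrow> real ^ 'n ^ 'm"
  assumes "open U" "smooth_on U A" "smooth_on U w"
  shows "smooth_on U (\<lambda>p. A p *v w p)"
proof -
  have "smooth_on U (\<lambda>p. w p $ j)" for j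
    using smooth_on_vec[OF assms(1), of w] assms(3) by blast
  then show ?thesis
    unfolding smooth_on_vec[OF assms(1)] matrix_vector_mult_def
    by (simp, intro allI smooth_on_sum smooth_on_mult smooth_on_matrix_entry assms)
qed

lemma smooth_on_transpose:
  fixes A :: "'a::euclidean_space \<Rightarrow> real ^ 'n ^ 'm"
  assumes "open U" "smooth_on U A"
  shows "smooth_on U (\<lambda>p. transpose (A p))"
  unfolding smooth_on_matrix_iff[OF assms(1)] transpose_def
  by (simp, intro allI smooth_on_matrix_entry assms)

lemma smooth_on_column:
  fixes A :: "'a::euclidean_space \<Rightarrow> real ^ 'n ^ 'm"
  assumes "open U" "smooth_on U A"
  shows "smooth_on U (\<lambda>p. column j (A p))"
  unfolding smooth_on_vec[OF assms(1)] column_def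
  by (simp, intro allI smooth_on_matrix_entry assms)

lemma column_jacobian: "column j (jacobian f (at p)) = frechet_derivative f (at p) (axis j 1)"
  by (simp add: column_def jacobian_def matrix_def vec_eq_iff)

lemma smooth_on_jacobian:
  fixes f :: "real ^ 'n \<Rightarrow> real ^ 'm"
  assumes "open U" "smooth_on U f"
  shows "smooth_on U (\<lambda>p. jacobian f (at p))"
proof -
  have "smooth_on U (\<lambda>p. frechet_derivative f (at p) (axis j 1) $ i)" for i j
    using smooth_on_frechet_derivative[OF assms(2), of "axis j 1"]
      smooth_on_vec[OF assms(1), of "\<lambda>p. frechet_derivative f (at p) (axis j 1)"] by blast
  then show ?thesis
    unfolding smooth_on_matrix_iff[OF assms(1)] by (simp add: jacobian_def matrix_def)
qed

lemma smooth_on_diff: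
  assumes "open U" "smooth_on U f" "smooth_on U g"
  shows "smooth_on U (\<lambda>p. f p - g p)"
  using smooth_on_add[OF assms(1,2) smooth_on_uminus[OF assms(1,3)]] by simp

lemma smooth_on_det_2:
  fixes A :: "'a::euclidean_space \<Rightarrow> real ^ 2 ^ 2"
  assumes "open U" "smooth_on U A"
  shows "smooth_on U (\<lambda>p. det (A p))"
  unfolding det_2 by (intro smooth_on_diff smooth_on_mult smooth_on_matrix_entry assms)

lemma smooth_on_adjugate_2:
  fixes A :: "'a::euclidean_space \<Rightarrow> real ^ 2 ^ 2"
  assumes "open U" "smooth_on U A"
  shows "smooth_on U (\<lambda>p. adjugate (A p))"
  unfolding smooth_on_matrix_iff[OF assms(1)] adjugate_2
  by (auto simp: forall_2 intro!: smooth_on_matrix_entry smooth_on_uminus assms)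

lemma matrix_inv_cancel:
  fixes A :: "real ^ 'n ^ 'n"
  assumes "det A \<noteq> 0"
  shows "A ** matrix_inv A = mat 1" "matrix_inv A ** A = mat 1"
proof -
  have "A ** matrix_inv A = mat 1 \<and> matrix_inv A ** A = mat 1"
    using assms unfolding matrix_inv_def invertible_det_nz[symmetric] invertible_def by (rule someI_ex)
  then show "A ** matrix_inv A = mat 1" "matrix_inv A ** A = mat 1" by auto
qed

lemma adjugate_2_mult:
  fixes A :: "real ^ 2 ^ 2"
  shows "adjugate A ** A = det A *\<^sub>R mat 1" and mult_adjugate_2: "A ** adjugate A = det A *\<^sub>R mat 1"
  by (simp_all add: adjugate_2 vec_eq_iff forall_2 det_2 matrix_matrix_mult_def sum_2 mat_def algebra_simps)

lemma scaleR_matrix_mult: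
  fixes A :: "real ^ 'n ^ 'm" and B :: "real ^ 'k ^ 'n"
  shows "(c *\<^sub>R A) ** B = c *\<^sub>R (A ** B)" "A ** (c *\<^sub>R B) = c *\<^sub>R (A ** B)"
  by (simp_all add: vec_eq_iff matrix_matrix_mult_def sum_distrib_left ac_simps)

lemma adjugate_2_eq_inverse:
  fixes A :: "real ^ 2 ^ 2"
  assumes "det A \<noteq> 0"
  shows "adjugate A = det A *\<^sub>R matrix_inv A"
proof -
  have "adjugate A = (adjugate A ** A) ** matrix_inv A"
    using matrix_inv_cancel[OF assms] by (simp add: matrix_mul_assoc[symmetric])
  then show ?thesis by (simp add: adjugate_2_mult scaleR_matrix_mult)
qed

lemma smooth_on_matrix_inv_2:
  fixes A :: "'a::euclidean_space \<Rightarrow> real ^ 2 ^ 2"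
  assumes "open U" "smooth_on U A" "\<And>p. p \<in> U \<Longrightarrow> det (A p) \<noteq> 0"
  shows "smooth_on U (\<lambda>p. matrix_inv (A p))"
proof -
  have "smooth_on U (\<lambda>p. inverse (det (A p)) *\<^sub>R adjugate (A p))"
    using assms by (intro smooth_on_scaleR smooth_on_inverse smooth_on_det_2 smooth_on_adjugate_2)
  then show ?thesis
    using assms(3) by (subst smooth_on_cong[OF assms(1)]) (auto simp: adjugate_2_eq_inverse)
qed

lemma smooth_on_cross3:
  assumes "open U" "smooth_on U f" "smooth_on U g"
  shows "smooth_on U (\<lambda>p. cross3 (f p) (g p))"
  using smooth_on_bilinear[OF assms(1) bilinear_conv_bounded_bilinear[THEN iffD1, OF bilinear_cross] assms(2,3)] .

lemma matrix_mult_uminus: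
  fixes A :: "real ^ 'n ^ 'm" and B :: "real ^ 'k ^ 'n"
  shows "(- A) ** B = - (A ** B)" "A ** (- B) = - (A ** B)"
  by (simp_all add: vec_eq_iff matrix_matrix_mult_def sum_negf)

lemma transpose_uminus: "transpose (- A) = - transpose (A :: real ^ 'n ^ 'm)"
  by (simp add: transpose_def vec_eq_iff)

lemma inner_matrix_transpose:
  fixes A :: "real ^ 'n ^ 'm"
  shows "x \<bullet> (A *v y) = (transpose A *v x) \<bullet> y"
  by (simp add: dot_lmul_matrix[symmetric])

section \<open>Bases of planes in three-space\<close>

lemma independent_pair_cross3:
  assumes "v \<noteq> w" "independent {v, w}"
  shows "cross3 v w \<noteq> 0"
proof
  assume "cross3 v w = 0"
  then have "v = 0 \<or> w = 0 \<or> (\<exists>c. w = c *\<^sub>R v)"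
    by (simp add: cross_eq_0 collinear_lemma)
  moreover have "v \<noteq> 0" "w \<noteq> 0"
    using assms(2) dependent_zero by auto
  moreover have False if "w = c *\<^sub>R v" for c
    using assms that by (auto simp: dependent_def insert_Diff_if span_base span_scale split: if_splits)
  ultimately show False by auto
qed

text \<open>
  Lagrange's identity. It shows that the Gram matrix of two linearly independent vectors is
  invertible.
\<close>

lemma det_gram:
  fixes W :: "real^2^3"
  shows "det (transpose W ** W) = cross3 (column 1 W) (column 2 W) \<bullet> cross3 (column 1 W) (column 2 W)"
  by (simp add: det_2 matrix_matrix_mult_def transpose_def sum_3 cross3_def inner_vec_def
      column_def vector_def algebra_simps)

lemma gram_inner: "v \<bullet> ((transpose W ** W) *v w) = (W *v v) \<bullet> (W *v w)"
  for W :: "real ^ 'n ^ 'm"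
  by (simp only: matrix_vector_mul_assoc[symmetric] inner_matrix_transpose[of v "transpose W"]
      transpose_transpose)

text \<open>
  With \<open>c = v \<times> w\<close>, expanding the triple product \<open>c \<times> (c \<times> z)\<close> in two ways expresses \<open>(c \<bullet> c) z\<close>
  as a combination of \<open>v\<close>, \<open>w\<close> and \<open>(z \<bullet> c) c\<close>, and the last term vanishes.
\<close>

lemma orthogonal_cross3_in_span:
  assumes "cross3 v w \<noteq> 0" "z \<bullet> cross3 v w = 0"
  shows "z \<in> span {v, w}"
proof -
  define c where "c = cross3 v w"
  have "(c \<bullet> c) *\<^sub>R z =
      ((v \<bullet> z) * (w \<bullet> w) - (w \<bullet> z) * (v \<bullet> w)) *\<^sub>R v + ((w \<bullet> z) * (v \<bullet> v) - (v \<bullet> z) * (v \<bullet> w)) *\<^sub>R w + (z \<bullet> c) *\<^sub>R c"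
    by (simp add: c_def cross3_simps vec_eq_iff forall_3)
  then have "z = inverse (c \<bullet> c) *\<^sub>R (((v \<bullet> z) * (w \<bullet> w) - (w \<bullet> z) * (v \<bullet> w)) *\<^sub>R v +
      ((w \<bullet> z) * (v \<bullet> v) - (v \<bullet> z) * (v \<bullet> w)) *\<^sub>R w)"
    using assms by (simp add: c_def[symmetric]) (metis inner_eq_zero_iff left_inverse scaleR_one scaleR_scaleR)
  also have "\<dots> \<in> span {v, w}"
    by (intro span_scale span_add span_base) auto
  finally show ?thesis .
qed

lemma in_span_columns:
  fixes W :: "real^2^3"
  assumes "v \<in> span {column 1 W, column 2 W}"
  obtains c where "v = W *v c"
proof -
  obtain a b where "v - a *\<^sub>R column 1 W = b *\<^sub>R column 2 W"
    using assms by (auto simp: span_breakdown_eq)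
  then have "v = W *v vector [a, b]"
    by (simp add: matrix_vector_mult_def column_def vec_eq_iff sum_2 algebra_simps)
  then show ?thesis by (rule that)
qed

text \<open>
  If \<open>X = W M\<close>, then \<open>X\<^sup>T W = M\<^sup>T (W\<^sup>T W)\<close>; so the coordinates \<open>M\<close> of the columns of \<open>X\<close> in the basis \<open>W\<close>
  are recovered by inverting the Gram matrix.
\<close>

lemma factor_through_frame:
  fixes W X :: "real^2^3"
  assumes "det (transpose W ** W) \<noteq> 0"
    and "\<And>j. column j X \<in> span {column 1 W, column 2 W}"
  shows "X = W ** transpose (transpose X ** W ** matrix_inv (transpose W ** W))"
proof -
  have "\<forall>j. \<exists>c. column j X = W *v c"
    using in_span_columns[OF assms(2)] by metis
  then obtain c where c: "\<And>j. column j X = W *v c j" by metis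
  define M :: "real^2^2" where "M = (\<chi> i j. c j $ i)"
  have "X = W ** M"
    using c by (auto simp: vec_eq_iff column_def M_def matrix_matrix_mult_def matrix_vector_mult_def)
  moreover have "transpose M ** (transpose W ** W) ** matrix_inv (transpose W ** W) = transpose M"
    by (simp add: matrix_mul_assoc[symmetric] matrix_inv_cancel[OF assms(1), unfolded matrix_mul_assoc[symmetric]])
  ultimately show ?thesis
    by (simp add: matrix_transpose_mul matrix_mul_assoc)
qed

section \<open>Tangent moving bases\<close>

lemma tmb_smooth: "tangent_moving_basis U x \<Omega> \<Longrightarrow> smooth_on U \<Omega>"
  by (simp add: tangent_moving_basis_def)

lemma tmb_cross3:
  "tangent_moving_basis U x \<Omega> \<Longrightarrow> p \<in> U \<Longrightarrow> cross3 (column 1 (\<Omega> p)) (column 2 (\<Omega> p)) \<noteq> 0"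
  unfolding tangent_moving_basis_def Let_def using independent_pair_cross3 by blast

lemma tmb_det: "tangent_moving_basis U x \<Omega> \<Longrightarrow> p \<in> U \<Longrightarrow> det (I_tmb \<Omega> p) \<noteq> 0"
  using tmb_cross3[of U x \<Omega> p] by (simp add: I_tmb_def det_gram)

lemma tmb_span:
  "tangent_moving_basis U x \<Omega> \<Longrightarrow> p \<in> U \<Longrightarrow>
    column j (jacobian x (at p)) \<in> span {column 1 (\<Omega> p), column 2 (\<Omega> p)}"
  unfolding tangent_moving_basis_def Let_def using exhaust_2[of j] by auto

text \<open>
  The relation \<open>Dx = \<Omega> \<Lambda>\<^sub>\<Omega>\<^sup>T\<close>, on which the computations below rest. It is stated for an arbitrary
  basis because it is also applied to other bases of \<open>x\<close> and to bases of \<open>n\<close>.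
\<close>

lemma jacobian_eq_frame_Lambda:
  assumes "tangent_moving_basis U x \<Omega>" "p \<in> U"
  shows "jacobian x (at p) = \<Omega> p ** transpose (Lambda_tmb x \<Omega> p)"
  unfolding Lambda_tmb_def I_tmb_def
  by (rule factor_through_frame[OF tmb_det[OF assms, unfolded I_tmb_def] tmb_span[OF assms]])

lemma smooth_I_tmb: "open U \<Longrightarrow> tangent_moving_basis U x \<Omega> \<Longrightarrow> smooth_on U (I_tmb \<Omega>)"
  unfolding I_tmb_def[abs_def] by (intro smooth_on_matrix_mult smooth_on_transpose tmb_smooth)

lemma smooth_inv_I_tmb:
  "open U \<Longrightarrow> tangent_moving_basis U x \<Omega> \<Longrightarrow> smooth_on U (\<lambda>p. matrix_inv (I_tmb \<Omega> p))"
  by (intro smooth_on_matrix_inv_2 smooth_I_tmb tmb_det)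

lemma smooth_Lambda_tmb:
  "open U \<Longrightarrow> smooth_on U x \<Longrightarrow> tangent_moving_basis U x \<Omega> \<Longrightarrow> smooth_on U (Lambda_tmb x \<Omega>)"
  unfolding Lambda_tmb_def[abs_def]
  by (intro smooth_on_matrix_mult smooth_on_transpose smooth_on_jacobian smooth_inv_I_tmb tmb_smooth)

lemma normal_field_orthogonal:
  assumes "v \<in> span {column 1 (\<Omega> p), column 2 (\<Omega> p)}"
  shows "normal_field \<Omega> p \<bullet> v = 0"
proof -
  have "orthogonal (normal_field \<Omega> p) v"
    by (rule orthogonal_to_span[OF assms])
       (auto simp: orthogonal_def normal_field_def Let_def dot_cross_self)
  then show ?thesis by (simp add: orthogonal_def)
qed

text \<open>
  The set where \<open>f\<close> does not vanish is open and contained in \<open>S\<close>. Properness of a frontal enters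
  through this lemma, with \<open>S\<close> its singular set.
\<close>

lemma continuous_zero_of_dense:
  fixes f :: "'a::euclidean_space \<Rightarrow> 'b::real_normed_vector"
  assumes "open U" "interior S = {}" "continuous_on U f" "\<And>p. p \<in> U - S \<Longrightarrow> f p = 0" "p \<in> U"
  shows "f p = 0"
proof (rule ccontr)
  assume "f p \<noteq> 0"
  have "open (f -` (- {0}) \<inter> U)"
    using assms(1,3) by (intro continuous_on_open_vimage[THEN iffD1, rule_format]) auto
  moreover have "f -` (- {0}) \<inter> U \<subseteq> S" using assms(4) by auto
  ultimately have "f -` (- {0}) \<inter> U \<subseteq> interior S" by (rule interior_maximal[rotated])
  then show False using \<open>f p \<noteq> 0\<close> assms(2,5) by auto
qed

section \<open>The geometry of a frontal with a fixed basis\<close>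

locale framed_frontal =
  fixes U :: "(real^2) set" and x n :: "real^2 \<Rightarrow> real^3" and \<Omega> :: "real^2 \<Rightarrow> real^2^3"
  assumes open_U: "open U" and smooth_x: "smooth_on U x"
    and tmb: "tangent_moving_basis U x \<Omega>" and n_def: "n = normal_field \<Omega>"
begin

lemma smooth_n: "smooth_on U n"
  unfolding n_def normal_field_def[abs_def] Let_def
  by (intro smooth_on_scaleR smooth_on_inverse_norm smooth_on_cross3 smooth_on_column
      tmb_smooth[OF tmb] open_U tmb_cross3[OF tmb])

lemma norm_n: "p \<in> U \<Longrightarrow> norm (n p) = 1"
  using tmb_cross3[OF tmb] by (simp add: n_def normal_field_def Let_def)

lemma smooth_II: "smooth_on U (II_tmb \<Omega>)"
  unfolding II_tmb_def[abs_def] n_def[symmetric]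
  by (intro smooth_on_uminus smooth_on_matrix_mult smooth_on_transpose smooth_on_jacobian smooth_n
      tmb_smooth[OF tmb] open_U)

lemma n_orthogonal_derivative_x: "p \<in> U \<Longrightarrow> n p \<bullet> column j (jacobian x (at p)) = 0"
  unfolding n_def by (rule normal_field_orthogonal[OF tmb_span[OF tmb]])

lemma n_orthogonal_derivative_n:
  assumes "p \<in> U"
  shows "n p \<bullet> column j (jacobian n (at p)) = 0"
proof -
  note diff = smooth_on_differentiable[OF smooth_n assms]
  have "frechet_derivative (\<lambda>q. n q \<bullet> n q) (at p) = frechet_derivative (\<lambda>q. 1) (at p)"
  proof (rule frechet_derivative_transform_within_open[OF _ open_U assms])
    show "(\<lambda>q. n q \<bullet> n q) differentiable at p" by (rule differentiable_inner[OF diff diff])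
    show "n q \<bullet> n q = 1" if "q \<in> U" for q using norm_n[OF that] by (simp add: dot_square_norm)
  qed
  then show ?thesis
    using fun_cong[of _ _ "axis j 1"] frechet_derivative_inner[OF diff diff]
    by (simp add: column_jacobian inner_commute fun_eq_iff)
qed

text \<open>
  The unit field \<open>n\<close> has derivatives orthogonal to itself, and the orthogonal complement of \<open>n\<close> is the
  plane spanned by \<open>\<Omega>\<close>.
\<close>

lemma tmb_n: "tangent_moving_basis U n \<Omega>"
proof -
  have "column j (jacobian n (at p)) \<in> span {column 1 (\<Omega> p), column 2 (\<Omega> p)}" if "p \<in> U" for p j
  proof (rule orthogonal_cross3_in_span)
    show "cross3 (column 1 (\<Omega> p)) (column 2 (\<Omega> p)) \<noteq> 0" by (rule tmb_cross3[OF tmb that])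
    then show "column j (jacobian n (at p)) \<bullet> cross3 (column 1 (\<Omega> p)) (column 2 (\<Omega> p)) = 0"
      using n_orthogonal_derivative_n[OF that, of j]
      by (simp add: n_def normal_field_def Let_def inner_commute)
  qed
  with tmb show ?thesis unfolding tangent_moving_basis_def Let_def by blast
qed

lemma frontal_n: "frontal U n"
  unfolding frontal_def
proof (intro conjI ballI)
  fix p assume "p \<in> U"
  then show "\<exists>V \<nu>. open V \<and> p \<in> V \<and> V \<subseteq> U \<and> smooth_on V \<nu> \<and> (\<forall>q\<in>V. norm (\<nu> q) = 1 \<and>
      \<nu> q \<bullet> column 1 (jacobian n (at q)) = 0 \<and> \<nu> q \<bullet> column 2 (jacobian n (at q)) = 0)"
    using open_U smooth_n norm_n n_orthogonal_derivative_n by blast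
qed (use smooth_n tmb_n in blast)+

text \<open>
  Insert \<open>Dx = \<Omega> \<Lambda>\<^sub>\<Omega>\<^sup>T\<close> into \<open>II = - Dx\<^sup>T Dn\<close>.
\<close>

lemma second_form_factor:
  assumes "p \<in> U"
  shows "second_form x n p = Lambda_tmb x \<Omega> p ** II_tmb \<Omega> p"
  unfolding second_form_def II_tmb_def n_def[symmetric] jacobian_eq_frame_Lambda[OF tmb assms]
  by (simp add: matrix_transpose_mul matrix_mul_assoc matrix_mult_uminus)

text \<open>
  Differentiating \<open>n \<bullet> x\<^sub>i = 0\<close> in the direction \<open>e\<^sub>j\<close> gives \<open>- x\<^sub>i \<bullet> n\<^sub>j = n \<bullet> x\<^sub>i\<^sub>j\<close>, and second derivatives
  commute.
\<close>

lemma second_form_symmetric: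
  assumes "p \<in> U"
  shows "transpose (second_form x n p) = second_form x n p"
proof -
  have entry: "second_form x n p $ i $ j = n p \<bullet>
      frechet_derivative (\<lambda>q. frechet_derivative x (at q) (axis i 1)) (at p) (axis j 1)" for i j
  proof -
    let ?xi = "\<lambda>q. frechet_derivative x (at q) (axis i 1)"
    have 0: "n q \<bullet> ?xi q = 0" if "q \<in> U" for q
      using n_orthogonal_derivative_x[OF that, of i] by (simp add: column_jacobian)
    note diff = smooth_on_differentiable[OF smooth_n assms]
      smooth_on_differentiable[OF smooth_on_frechet_derivative[OF smooth_x] assms]
    have "frechet_derivative (\<lambda>q. n q \<bullet> ?xi q) (at p) = frechet_derivative (\<lambda>q. 0) (at p)"
      using frechet_derivative_transform_within_open[OF _ open_U assms, of "\<lambda>q. n q \<bullet> ?xi q" "\<lambda>q. 0"]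
        diff 0 by (simp add: differentiable_inner)
    then have "n p \<bullet> frechet_derivative ?xi (at p) (axis j 1) + frechet_derivative n (at p) (axis j 1) \<bullet> ?xi p = 0"
      using frechet_derivative_inner[OF diff(1) diff(2)[of "axis i 1"], of "axis j 1"] by simp
    moreover have "second_form x n p $ i $ j = - (?xi p \<bullet> frechet_derivative n (at p) (axis j 1))"
      by (simp add: second_form_def column_jacobian[symmetric] matrix_matrix_mult_def transpose_def
          column_def inner_vec_def)
    ultimately show ?thesis by (simp add: inner_commute)
  qed
  show ?thesis
    by (simp add: vec_eq_iff transpose_def entry mixed_derivatives_commute[OF open_U smooth_x assms])
qed

text \<open>
  \<open>\<Lambda>\<^sub>\<Omega>\<^sup>T\<close> is the inner factor of the injective map \<open>Dx = \<Omega> \<Lambda>\<^sub>\<Omega>\<^sup>T\<close>, hence injective.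
\<close>

lemma Lambda_regular:
  assumes "p \<in> U - singular_set U x"
  shows "det (transpose (Lambda_tmb x \<Omega> p)) \<noteq> 0"
proof -
  have p: "p \<in> U" and inj: "inj (frechet_derivative x (at p))"
    using assms by (auto simp: singular_set_def)
  have "frechet_derivative x (at p) = (\<lambda>v. jacobian x (at p) *v v)"
    using smooth_on_differentiable[OF smooth_x p] frechet_derivative_at jacobian_works by metis
  also have "\<dots> = (\<lambda>w. \<Omega> p *v w) \<circ> (\<lambda>v. transpose (Lambda_tmb x \<Omega> p) *v v)"
    unfolding jacobian_eq_frame_Lambda[OF tmb p] by (simp only: comp_def matrix_vector_mul_assoc)
  finally have "inj (\<lambda>v. transpose (Lambda_tmb x \<Omega> p) *v v)"
    using inj inj_on_imageI2 by metis
  then obtain B where "B ** transpose (Lambda_tmb x \<Omega> p) = mat 1"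
    using matrix_left_invertible_injective by metis
  then show ?thesis
    using invertible_det_nz invertible_left_inverse by blast
qed

lemma quadratic_I_tmb_pos: 
  assumes "p \<in> U" "\<omega> \<noteq> 0"
  shows "\<omega> \<bullet> (I_tmb \<Omega> p *v \<omega>) \<noteq> 0"
proof
  assume "\<omega> \<bullet> (I_tmb \<Omega> p *v \<omega>) = 0"
  then have "\<Omega> p *v \<omega> = 0" by (simp only: I_tmb_def gram_inner inner_eq_zero_iff)
  then have "I_tmb \<Omega> p *v \<omega> = 0"
    by (simp add: I_tmb_def matrix_vector_mul_assoc[symmetric] del: matrix_vector_mul_assoc transpose_matrix_vector)
  then have "matrix_inv (I_tmb \<Omega> p) *v (I_tmb \<Omega> p *v \<omega>) = 0" by simp
  then show False
    using assms(2) matrix_inv_cancel(2)[OF tmb_det[OF tmb assms(1)]]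
    by (simp only: matrix_vector_mul_assoc matrix_vector_mul_lid)
qed

text \<open>
  For \<open>\<zeta> = \<Lambda>\<^sub>\<Omega>\<^sup>-\<^sup>T \<omega>\<close> one has \<open>Dx \<zeta> = \<Omega> \<omega>\<close>, so the first fundamental form at \<open>\<zeta>\<close> is the Gram form of
  \<open>\<Omega>\<close> at \<open>\<omega>\<close>, which does not degenerate at singular points.
\<close>

lemma normal_curvature_in_frame:
  assumes "p \<in> U - singular_set U x"
  shows "normal_curvature x n p (matrix_inv (transpose (Lambda_tmb x \<Omega> p)) *v \<omega>) =
    (\<omega> \<bullet> ((II_tmb \<Omega> p ** matrix_inv (transpose (Lambda_tmb x \<Omega> p))) *v \<omega>)) / (\<omega> \<bullet> (I_tmb \<Omega> p *v \<omega>))"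
proof -
  let ?L = "Lambda_tmb x \<Omega> p" and ?M = "matrix_inv (transpose (Lambda_tmb x \<Omega> p))"
  have p: "p \<in> U" using assms by simp
  have LM: "transpose ?L *v (?M *v \<omega>) = \<omega>"
    using matrix_inv_cancel(1)[OF Lambda_regular[OF assms]]
    by (simp only: matrix_vector_mul_assoc matrix_vector_mul_lid)
  have "(?M *v \<omega>) \<bullet> (second_form x n p *v (?M *v \<omega>)) = \<omega> \<bullet> ((II_tmb \<Omega> p ** ?M) *v \<omega>)"
    unfolding second_form_factor[OF p] matrix_vector_mul_assoc[symmetric]
      inner_matrix_transpose[of _ ?L] LM ..
  moreover have "(?M *v \<omega>) \<bullet> (first_form x p *v (?M *v \<omega>)) = \<omega> \<bullet> (I_tmb \<Omega> p *v \<omega>)"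
  proof -
    have "jacobian x (at p) *v (?M *v \<omega>) = \<Omega> p *v \<omega>"
      by (simp only: jacobian_eq_frame_Lambda[OF tmb p] matrix_vector_mul_assoc[symmetric] LM)
    then show ?thesis by (simp only: first_form_def I_tmb_def gram_inner)
  qed
  ultimately show ?thesis by (simp only: normal_curvature_def)
qed

text \<open>
  On immersive points the matrix equals \<open>\<Lambda>\<^sub>\<Omega>\<^sup>-\<^sup>1 II \<Lambda>\<^sub>\<Omega>\<^sup>-\<^sup>T\<close>, a congruence transform of the symmetric
  matrix \<open>II\<close>.
\<close>

lemma II_inv_Lambda_symmetric:
  assumes "p \<in> U - singular_set U x"
  shows "transpose (II_tmb \<Omega> p ** matrix_inv (transpose (Lambda_tmb x \<Omega> p)))
    = II_tmb \<Omega> p ** matrix_inv (transpose (Lambda_tmb x \<Omega> p))"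
proof -
  let ?L = "Lambda_tmb x \<Omega> p" and ?M = "matrix_inv (transpose (Lambda_tmb x \<Omega> p))"
  have p: "p \<in> U" using assms by simp
  have "transpose ?M ** ?L = transpose (transpose ?L ** ?M)"
    by (simp add: matrix_transpose_mul)
  then have MTL: "transpose ?M ** ?L = mat 1"
    using matrix_inv_cancel(1)[OF Lambda_regular[OF assms]] by simp
  then have "II_tmb \<Omega> p ** ?M = transpose ?M ** second_form x n p ** ?M"
    by (simp add: second_form_factor[OF p] matrix_mul_assoc)
  then show ?thesis
    by (simp add: matrix_transpose_mul second_form_symmetric[OF p] matrix_mul_assoc)
qed

section \<open>The three conditions\<close>

abbreviation "II_adj p \<equiv> II_tmb \<Omega> p ** adjugate (transpose (Lambda_tmb x \<Omega> p))"

lemma II_adj_regular: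
  assumes "p \<in> U - singular_set U x"
  shows "II_adj p = lambda_tmb x \<Omega> p *\<^sub>R (II_tmb \<Omega> p ** matrix_inv (transpose (Lambda_tmb x \<Omega> p)))"
  using adjugate_2_eq_inverse[OF Lambda_regular[OF assms]]
  by (simp add: scaleR_matrix_mult lambda_tmb_def)

lemma smooth_II_adj: "smooth_on U II_adj"
  by (intro smooth_on_matrix_mult smooth_II smooth_on_adjugate_2 smooth_on_transpose smooth_Lambda_tmb
      open_U smooth_x tmb)

text \<open>
  Collects the entrywise quotients by \<open>\<lambda>\<^sub>\<Omega>\<close> into one smooth matrix, the form in which the ideal condition is
  used and established below.
\<close>

lemma ideal_iff_smooth_quotient:
  "(\<forall>i j. (\<lambda>p. II_adj p $ i $ j) \<in> T_ideal U x \<Omega>) \<longleftrightarrow>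
    (\<exists>C. smooth_on U C \<and> (\<forall>p\<in>U. II_adj p = lambda_tmb x \<Omega> p *\<^sub>R C p))"
proof
  assume "\<forall>i j. (\<lambda>p. II_adj p $ i $ j) \<in> T_ideal U x \<Omega>"
  then have "\<forall>i j. \<exists>h. smooth_on U h \<and> (\<forall>p\<in>U. II_adj p $ i $ j = h p * lambda_tmb x \<Omega> p)"
    by (simp add: T_ideal_def principal_ideal_on_def)
  then obtain c where c: "\<And>i j. smooth_on U (c i j)"
    "\<And>i j p. p \<in> U \<Longrightarrow> II_adj p $ i $ j = c i j p * lambda_tmb x \<Omega> p"
    by metis
  have "smooth_on U (\<lambda>p. \<chi> i j. c i j p)"
    using c(1) by (simp add: smooth_on_matrix_iff[OF open_U])
  moreover have "II_adj p = lambda_tmb x \<Omega> p *\<^sub>R (\<chi> i j. c i j p)" if "p \<in> U" for p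
    using c(2)[OF that] by (simp add: vec_eq_iff mult.commute)
  ultimately show "\<exists>C. smooth_on U C \<and> (\<forall>p\<in>U. II_adj p = lambda_tmb x \<Omega> p *\<^sub>R C p)" by blast
next
  assume "\<exists>C. smooth_on U C \<and> (\<forall>p\<in>U. II_adj p = lambda_tmb x \<Omega> p *\<^sub>R C p)"
  then obtain C where C: "smooth_on U C" "\<And>p. p \<in> U \<Longrightarrow> II_adj p = lambda_tmb x \<Omega> p *\<^sub>R C p" by blast
  have "(\<lambda>p. II_adj p $ i $ j) \<in> T_ideal U x \<Omega>" for i j
    unfolding T_ideal_def principal_ideal_on_def
    using smooth_on_matrix_entry[OF open_U C(1), of i j] C(2)
    by (auto intro!: exI[of _ "\<lambda>p. C p $ i $ j"])
  then show "\<forall>i j. (\<lambda>p. II_adj p $ i $ j) \<in> T_ideal U x \<Omega>" by blast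
qed

text \<open>
  The quotient matrix \<open>C\<close> extends \<open>II\<^sub>\<Omega> \<Lambda>\<^sub>\<Omega>\<^sup>-\<^sup>T\<close> smoothly, so the formula of
  \<open>normal_curvature_in_frame\<close> with \<open>C\<close> in its place is the extension.
\<close>

lemma extendable_if_ideal:
  assumes "\<forall>i j. (\<lambda>p. II_adj p $ i $ j) \<in> T_ideal U x \<Omega>"
  shows "normal_curvature_extendable U x \<Omega>"
  unfolding normal_curvature_extendable_def n_def[symmetric]
proof -
  obtain C where C: "smooth_on U C" "\<And>p. p \<in> U \<Longrightarrow> II_adj p = lambda_tmb x \<Omega> p *\<^sub>R C p"
    using assms unfolding ideal_iff_smooth_quotient by blast
  let ?D = "U \<times> (UNIV - {0 :: real^2})"
  let ?K = "\<lambda>z. (snd z \<bullet> (C (fst z) *v snd z)) * inverse (snd z \<bullet> (I_tmb \<Omega> (fst z) *v snd z))"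
  have D: "open ?D" by (intro open_Times open_U open_Diff) auto
  have fst: "smooth_on ?D (\<lambda>z. A (fst z))" if "smooth_on U A" for A :: "real^2 \<Rightarrow> real^2^2"
    using smooth_on_affine[OF open_U D bounded_linear_fst, of 0 A] that by auto
  have snd: "smooth_on ?D snd"
    using smooth_on_linear[OF D bounded_linear_snd smooth_on_ident[OF D]] .
  have "smooth_on ?D ?K"
    by (intro smooth_on_mult smooth_on_inverse smooth_on_inner smooth_on_matrix_vector_mult D fst snd C(1)
        smooth_I_tmb[OF open_U tmb]) (auto simp: quadratic_I_tmb_pos)
  moreover have "?K (p, \<omega>) = normal_curvature x n p (matrix_inv (transpose (Lambda_tmb x \<Omega> p)) *v \<omega>)"
    if p: "p \<in> U - singular_set U x" for p \<omega>
  proof -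
    have "lambda_tmb x \<Omega> p \<noteq> 0" using Lambda_regular[OF p] by (simp add: lambda_tmb_def)
    then have "C p = II_tmb \<Omega> p ** matrix_inv (transpose (Lambda_tmb x \<Omega> p))"
      using II_adj_regular[OF p] C(2)[of p] p by simp
    then show ?thesis
      unfolding normal_curvature_in_frame[OF p] by (simp add: divide_inverse)
  qed
  ultimately show "\<exists>K. smooth_on ?D K \<and> (\<forall>p \<in> U - singular_set U x. \<forall>\<omega> \<in> UNIV - {0}.
      K (p, \<omega>) = normal_curvature x n p (matrix_inv (transpose (Lambda_tmb x \<Omega> p)) *v \<omega>))"
    by (intro exI[of _ ?K]) simp
qed

text \<open>
  The values of the form at \<open>e\<^sub>1\<close>, \<open>e\<^sub>2\<close> and \<open>e\<^sub>1 + e\<^sub>2\<close> suffice. Having the entries explicitly in terms of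
  nonzero arguments is what allows the matrix to be extended smoothly, since the extended curvature is
  only available at nonzero vectors.
\<close>

lemma symmetric_matrix_2_polarization:
  fixes S :: "real^2^2"
  assumes "transpose S = S"
  defines "q \<equiv> \<lambda>w. w \<bullet> (S *v w)"
  shows "S = vector [vector [q (axis 1 1), (q (axis 1 1 + axis 2 1) - q (axis 1 1) - q (axis 2 1)) / 2],
    vector [(q (axis 1 1 + axis 2 1) - q (axis 1 1) - q (axis 2 1)) / 2, q (axis 2 1)]]"
proof -
  have "S $ 2 $ 1 = transpose S $ 1 $ 2" by (simp add: transpose_def)
  then have "S $ 2 $ 1 = S $ 1 $ 2" by (simp only: assms(1))
  then show ?thesis
    by (simp add: q_def vec_eq_iff forall_2 inner_vec_def sum_2 matrix_vector_mult_def axis_def)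
qed

text \<open>
  Multiplying the extended curvature by the Gram form gives smooth functions that agree on immersive
  points with the quadratic form of the symmetric matrix \<open>II\<^sub>\<Omega> \<Lambda>\<^sub>\<Omega>\<^sup>-\<^sup>T\<close>. Polarization recovers its
  entries as smooth functions on all of \<open>U\<close>, and density carries the identity to the singular points.
\<close>

lemma ideal_if_extendable:
  assumes dense: "interior (singular_set U x) = {}" and ext: "normal_curvature_extendable U x \<Omega>"
  shows "\<forall>i j. (\<lambda>p. II_adj p $ i $ j) \<in> T_ideal U x \<Omega>"
proof -
  let ?D = "U \<times> (UNIV - {0 :: real^2})"
  obtain K where K: "smooth_on ?D K"
    and K_eq: "\<And>p \<omega>. p \<in> U - singular_set U x \<Longrightarrow> \<omega> \<noteq> 0 \<Longrightarrow>
      K (p, \<omega>) = normal_curvature x n p (matrix_inv (transpose (Lambda_tmb x \<Omega> p)) *v \<omega>)"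
    using ext unfolding normal_curvature_extendable_def n_def[symmetric] by blast
  have D: "open ?D" by (intro open_Times open_U open_Diff) auto
  define q where "q p \<omega> = K (p, \<omega>) * (\<omega> \<bullet> (I_tmb \<Omega> p *v \<omega>))" for p \<omega>
  have smooth_q: "smooth_on U (\<lambda>p. q p \<omega>)" if "\<omega> \<noteq> 0" for \<omega>
  proof -
    have "bounded_linear (\<lambda>p :: real^2. (p, 0 :: real^2))"
      by (intro bounded_linear_Pair bounded_linear_ident bounded_linear_zero)
    from smooth_on_affine[OF D open_U this, of "(0, \<omega>)" K]
    have "smooth_on U (\<lambda>p. K (p, \<omega>))" using that K by auto
    then show ?thesis
      unfolding q_def
      by (intro smooth_on_mult smooth_on_inner smooth_on_matrix_vector_mult smooth_on_const open_U
          smooth_I_tmb[OF open_U tmb])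
  qed
  define C :: "real^2 \<Rightarrow> real^2^2" where
    "C p = vector [vector [q p (axis 1 1), (q p (axis 1 1 + axis 2 1) - q p (axis 1 1) - q p (axis 2 1)) / 2],
      vector [(q p (axis 1 1 + axis 2 1) - q p (axis 1 1) - q p (axis 2 1)) / 2, q p (axis 2 1)]]" for p
  have nz: "axis 1 1 \<noteq> (0 :: real^2)" "axis 2 1 \<noteq> (0 :: real^2)" "axis 1 1 + axis 2 1 \<noteq> (0 :: real^2)"
    by (simp_all add: vec_eq_iff forall_2 axis_def)
  have "smooth_on U (\<lambda>p. (q p (axis 1 1 + axis 2 1) - q p (axis 1 1) - q p (axis 2 1)) / 2)"
    unfolding divide_inverse by (intro smooth_q nz smooth_on_mult smooth_on_diff smooth_on_const open_U)
  then have "smooth_on U C"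
    by (simp add: smooth_on_matrix_iff[OF open_U] forall_2 C_def smooth_q nz)
  moreover have "II_adj p = lambda_tmb x \<Omega> p *\<^sub>R C p" if p: "p \<in> U - singular_set U x" for p
  proof -
    let ?S = "II_tmb \<Omega> p ** matrix_inv (transpose (Lambda_tmb x \<Omega> p))"
    have "q p \<omega> = \<omega> \<bullet> (?S *v \<omega>)" if "\<omega> \<noteq> 0" for \<omega>
      using quadratic_I_tmb_pos[OF _ that] p
      unfolding q_def K_eq[OF p that] normal_curvature_in_frame[OF p] by simp
    then have "C p = ?S"
      unfolding C_def using symmetric_matrix_2_polarization[OF II_inv_Lambda_symmetric[OF p]] nz by metis
    then show ?thesis using II_adj_regular[OF p] by simp
  qed
  moreover have "continuous_on U (\<lambda>p. II_adj p - lambda_tmb x \<Omega> p *\<^sub>R C p)"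
    unfolding lambda_tmb_def
    by (intro smooth_on_imp_continuous_on smooth_on_diff smooth_on_scaleR smooth_on_det_2 smooth_II_adj
        smooth_Lambda_tmb open_U smooth_x tmb) fact
  ultimately have "II_adj p - lambda_tmb x \<Omega> p *\<^sub>R C p = 0" if "p \<in> U" for p
    using continuous_zero_of_dense[OF open_U dense _ _ that, of "\<lambda>p. II_adj p - lambda_tmb x \<Omega> p *\<^sub>R C p"]
    by simp
  then show ?thesis
    unfolding ideal_iff_smooth_quotient using \<open>smooth_on U C\<close> by (intro exI[of _ C]) simp
qed

text \<open>
  The same basis \<open>\<Omega>\<close> serves for \<open>x\<close> and for \<open>n\<close>. At immersive points \<open>C = II\<^sub>\<Omega> \<Lambda>\<^sub>\<Omega>\<^sup>-\<^sup>T\<close>, and the resulting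
  factorization \<open>II\<^sub>\<Omega> = C \<Lambda>\<^sub>\<Omega>\<^sup>T\<close> no longer contains an inverse, so it extends by continuity.
\<close>

lemma precsim_if_ideal:
  assumes dense: "interior (singular_set U x) = {}" and x: "frontal U x"
    and ideal: "\<forall>i j. (\<lambda>p. II_adj p $ i $ j) \<in> T_ideal U x \<Omega>"
  shows "frontal_precsim U x n"
proof -
  obtain C where C: "smooth_on U C" "\<And>p. p \<in> U \<Longrightarrow> II_adj p = lambda_tmb x \<Omega> p *\<^sub>R C p"
    using ideal unfolding ideal_iff_smooth_quotient by blast
  let ?L = "Lambda_tmb x \<Omega>"
  have L: "smooth_on U ?L" by (rule smooth_Lambda_tmb[OF open_U smooth_x tmb])
  have "II_tmb \<Omega> p - C p ** transpose (?L p) = 0" if "p \<in> U" for p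
  proof (rule continuous_zero_of_dense[OF open_U dense _ _ that])
    show "continuous_on U (\<lambda>p. II_tmb \<Omega> p - C p ** transpose (?L p))"
      by (intro smooth_on_imp_continuous_on smooth_on_diff smooth_on_matrix_mult smooth_on_transpose
          smooth_II open_U C L)
    fix p assume p: "p \<in> U - singular_set U x"
    have "lambda_tmb x \<Omega> p \<noteq> 0" using Lambda_regular[OF p] by (simp add: lambda_tmb_def)
    then have "C p = II_tmb \<Omega> p ** matrix_inv (transpose (?L p))"
      using II_adj_regular[OF p] C(2)[of p] p by simp
    then show "II_tmb \<Omega> p - C p ** transpose (?L p) = 0"
      using matrix_inv_cancel(2)[OF Lambda_regular[OF p]] by (simp add: matrix_mul_assoc[symmetric])
  qed
  then have II: "II_tmb \<Omega> p = C p ** transpose (?L p)" if "p \<in> U" for p using that by simp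
  \<comment> \<open>Forced by \<open>\<Lambda>\<^sub>\<Omega>(n) = - II\<^sub>\<Omega>\<^sup>T I\<^sub>\<Omega>\<^sup>-\<^sup>1\<close> and \<open>II\<^sub>\<Omega>\<^sup>T = L C\<^sup>T\<close>.\<close>
  define B where "B p = - (transpose (C p) ** matrix_inv (I_tmb \<Omega> p))" for p
  have "smooth_on U B"
    unfolding B_def[abs_def]
    by (intro smooth_on_uminus smooth_on_matrix_mult smooth_on_transpose smooth_inv_I_tmb[OF open_U tmb] open_U C)
  moreover have "Lambda_tmb n \<Omega> p = ?L p ** B p" if "p \<in> U" for p
  proof -
    have "transpose (jacobian n (at p)) ** \<Omega> p = - transpose (II_tmb \<Omega> p)"
      by (simp add: II_tmb_def n_def transpose_uminus matrix_transpose_mul)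
    then have "Lambda_tmb n \<Omega> p = - (transpose (II_tmb \<Omega> p) ** matrix_inv (I_tmb \<Omega> p))"
      by (simp add: Lambda_tmb_def matrix_mult_uminus)
    then show ?thesis
      by (simp add: II[OF that] B_def matrix_transpose_mul matrix_mult_uminus matrix_mul_assoc)
  qed
  ultimately show ?thesis
    unfolding frontal_precsim_def using x frontal_n tmb tmb_n by blast
qed

text \<open>
  The two bases may differ from \<open>\<Omega>\<close> and from each other; the one for \<open>n\<close> need not even span the same
  plane where \<open>Dn\<close> is singular. Only the products \<open>\<Omega>\<^sup>T \<Omega>\<^sub>1\<close> and \<open>\<Omega>\<^sup>T \<Omega>\<^sub>2\<close> enter, and these are smooth.
\<close>

lemma ideal_if_precsim:
  assumes "frontal_precsim U x n"
  shows "\<forall>i j. (\<lambda>p. II_adj p $ i $ j) \<in> T_ideal U x \<Omega>"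
proof -
  obtain \<Omega>1 \<Omega>2 B where t1: "tangent_moving_basis U x \<Omega>1" and t2: "tangent_moving_basis U n \<Omega>2"
    and B: "smooth_on U B" "\<And>p. p \<in> U \<Longrightarrow> Lambda_tmb n \<Omega>2 p = Lambda_tmb x \<Omega>1 p ** B p"
    using assms unfolding frontal_precsim_def by blast
  \<comment> \<open>The change of basis from \<open>\<Omega>\<close> to \<open>\<Omega>1\<close>: substituting \<open>Dx = \<Omega> L\<^sup>T\<close> into the definition of
    \<open>\<Lambda>\<close> for \<open>\<Omega>1\<close> gives \<open>L P\<close>.\<close>
  define P where "P p = transpose (\<Omega> p) ** \<Omega>1 p ** matrix_inv (I_tmb \<Omega>1 p)" for p
  \<comment> \<open>Chosen so that \<open>II\<^sub>\<Omega> = - \<Omega>\<^sup>T Dn = C L\<^sup>T\<close> after \<open>Dn = \<Omega>2 (L P B)\<^sup>T\<close>.\<close>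
  define C where "C p = - (transpose (\<Omega> p) ** \<Omega>2 p ** transpose (P p ** B p))" for p
  have "smooth_on U C"
    unfolding C_def[abs_def] P_def
    by (intro smooth_on_uminus smooth_on_matrix_mult smooth_on_transpose smooth_inv_I_tmb[OF open_U t1]
        tmb_smooth[OF tmb] tmb_smooth[OF t1] tmb_smooth[OF t2] open_U B(1))
  moreover have "II_adj p = lambda_tmb x \<Omega> p *\<^sub>R C p" if p: "p \<in> U" for p
  proof -
    have "Lambda_tmb x \<Omega>1 p = Lambda_tmb x \<Omega> p ** P p"
      unfolding Lambda_tmb_def[of x \<Omega>1] jacobian_eq_frame_Lambda[OF tmb p]
      by (simp add: matrix_transpose_mul P_def matrix_mul_assoc)
    then have "jacobian n (at p) = \<Omega>2 p ** transpose (P p ** B p) ** transpose (Lambda_tmb x \<Omega> p)"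
      unfolding jacobian_eq_frame_Lambda[OF t2 p] B(2)[OF p]
      by (simp add: matrix_transpose_mul matrix_mul_assoc)
    then have "II_tmb \<Omega> p = C p ** transpose (Lambda_tmb x \<Omega> p)"
      by (simp add: II_tmb_def n_def[symmetric] C_def matrix_mult_uminus matrix_mul_assoc)
    then show ?thesis
      by (simp add: matrix_mul_assoc[symmetric] mult_adjugate_2 scaleR_matrix_mult lambda_tmb_def)
  qed
  ultimately show ?thesis unfolding ideal_iff_smooth_quotient by blast
qed

end

theorem theorem3p1:
  fixes U :: "(real^2) set"
    and x n :: "real^2 \<Rightarrow> real^3"
    and \<Omega> :: "real^2 \<Rightarrow> real^2^3"
  assumes "open U"
    and "proper_frontal U x"
    and "tangent_moving_basis U x \<Omega>"
    and "n = normal_field \<Omega>"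
  shows "(normal_curvature_extendable U x \<Omega> \<longleftrightarrow>
            (\<forall>i j. (\<lambda>p. (II_tmb \<Omega> p ** adjugate (transpose (Lambda_tmb x \<Omega> p))) $ i $ j)
                     \<in> T_ideal U x \<Omega>))
       \<and> ((\<forall>i j. (\<lambda>p. (II_tmb \<Omega> p ** adjugate (transpose (Lambda_tmb x \<Omega> p))) $ i $ j)
                     \<in> T_ideal U x \<Omega>) \<longleftrightarrow>
            frontal_precsim U x n)"
proof -
  have x: "frontal U x" and dense: "interior (singular_set U x) = {}"
    using assms(2) by (auto simp: proper_frontal_def)
  interpret framed_frontal U x n \<Omega>
    using assms x by unfold_locales (auto simp: frontal_def)
  show ?thesis
    using extendable_if_ideal ideal_if_extendable[OF dense] precsim_if_ideal[OF dense x] ideal_if_precsim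
    by blast
qed

end
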